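(* Let $p$ be an odd prime and $m\in\mathbb Z_p$ with $(m+2)(m-2)\not\equiv0\pmod p$. Then $$\sum_{k=0}^{p-1}\binom{2k}k\frac{a_k}{(m+2)^k}\equiv\left(\frac{(m+2)(m-2)}p\right)\sum_{k=0}^{p-1}\binom{2k}k\frac{f_k}{(m-2)^k}\pmod p,$$ $$\sum_{k=0}^{p-1}\binom{2k}k\frac{Q_k}{(-8(m+2))^k}\equiv\left(\frac{(m+2)(m-2)}p\right)\sum_{k=0}^{p-1}\binom{2k}k\frac{f_k}{(-8(m-2))^k}\pmod p,$$ $$\sum_{k=0}^{p-1}\binom{2k}k\frac{Q_k}{(-9(m+2))^k}\equiv\left(\frac{(m+2)(m-2)}p\right)\sum_{k=0}^{p-1}\binom{2k}k\frac{a_k}{(-9(m-2))^k}\pmod p,$$ and, if moreover $9m-14\not\equiv0\pmod p$, $$\sum_{k=0}^{p-1}\binom{2k}k\frac{Q_k}{(-9(m+2))^k}\equiv\left(\frac{(m+2)(9m-14)}p\right)\sum_{k=0}^{p-1}\binom{2k}k\frac{f_k}{(-9m+14)^k}\pmod p.$$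
   Context: $f_n=\sum_{k=0}^n\binom nk^3$, $a_n=\sum_{k=0}^n\binom nk^2\binom{2k}k$, $Q_n=\sum_{k=0}^n\binom nk(-8)^{n-k}f_k$. $\mathbb Z_p$: rationals with denominator prime to $p$; congruences mod $p$ are in $\mathbb Z_p$. $\left(\frac{\cdot}{p}\right)$ is the Legendre symbol.
   Formalization: The third and fourth congruences are stated only for p ≠ 3; for p = 3 they fail for every admissible m, since the left side is not in Z_3 (for m = 0 it equals 22/9). *)

theory Defs
  imports "HOL-Number_Theory.Number_Theory" Complex_Main
begin

definition f_num :: "nat \<Rightarrow> nat" where
  "f_num n = (\<Sum>k=0..n. (n choose k) ^ 3)"

definition a_num :: "nat \<Rightarrow> nat" where
  "a_num n = (\<Sum>k=0..n. (n choose k)\<^sup>2 * ((2 * k) choose k))"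

definition Q_num :: "nat \<Rightarrow> int" where
  "Q_num n = (\<Sum>k=0..n. int (n choose k) * (-8) ^ (n - k) * int (f_num k))"

text \<open>The ring of rationals with denominator prime to \<open>p\<close>
  (\<^const>\<open>quotient_of\<close> yields the reduced fraction).\<close>

definition Zp :: "nat \<Rightarrow> rat set" where
  "Zp p = {x. coprime (snd (quotient_of x)) (int p)}"

text \<open>Congruence modulo \<open>p\<close> in \<open>Zp p\<close>. Both sides are required to be
  \<open>p\<close>-integral, so a congruence between rationals outside \<open>Zp p\<close> is false.\<close>

definition cong_Zp :: "nat \<Rightarrow> rat \<Rightarrow> rat \<Rightarrow> bool" where
  "cong_Zp p x y \<longleftrightarrow> x \<in> Zp p \<and> y \<in> Zp p \<and> (\<exists>z\<in>Zp p. x - y = of_nat p * z)"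

text \<open>The Legendre symbol for arguments in \<open>Zp p\<close>; it extends the library's
  \<^const>\<open>Legendre\<close>, see \<open>Legendre_Zp_of_int\<close> below.\<close>

definition Legendre_Zp :: "rat \<Rightarrow> nat \<Rightarrow> int" where
  "Legendre_Zp x p =
    (if cong_Zp p x 0 then 0
     else if \<exists>y\<in>Zp p. cong_Zp p (y\<^sup>2) x then 1
     else -1)"

lemma Zp_iff: "x \<in> Zp p \<longleftrightarrow> (\<exists>a b. b \<noteq> 0 \<and> coprime b (int p) \<and> x = of_int a / of_int b)"
proof
  assume "x \<in> Zp p"
  moreover obtain a b where ab: "quotient_of x = (a, b)" by fastforce
  ultimately have "coprime b (int p)" by (simp add: Zp_def)
  moreover have "b \<noteq> 0" using quotient_of_denom_pos[OF ab] by simp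
  ultimately show "\<exists>a b. b \<noteq> 0 \<and> coprime b (int p) \<and> x = of_int a / of_int b"
    using quotient_of_div[OF ab] by blast
next
  assume "\<exists>a b. b \<noteq> 0 \<and> coprime b (int p) \<and> x = of_int a / of_int b"
  then obtain a b where b: "b \<noteq> 0" "coprime b (int p)" and x: "x = of_int a / of_int b"
    by blast
  obtain c d where cd: "quotient_of x = (c, d)" by fastforce
  have d: "d > 0" "coprime c d" and x': "x = of_int c / of_int d"
    using quotient_of_denom_pos[OF cd] quotient_of_coprime[OF cd] quotient_of_div[OF cd] by auto
  have "(of_int (a * d) :: rat) = of_int (c * b)"
    using x x' b d by (simp add: field_simps)
  hence "a * d = c * b" by (simp only: of_int_eq_iff)
  hence "d dvd c * b" by (metis dvd_triv_right)
  hence "d dvd b" using d(2) by (metis coprime_commute coprime_dvd_mult_right_iff)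
  hence "coprime d (int p)" using b(2) by (rule coprime_divisors[OF _ dvd_refl])
  thus "x \<in> Zp p" by (simp add: Zp_def cd)
qed

lemma of_int_Zp [simp]: "of_int a \<in> Zp p"
  unfolding Zp_iff by (rule exI[of _ a], rule exI[of _ 1]) simp

lemma Zp_add: "x \<in> Zp p \<Longrightarrow> y \<in> Zp p \<Longrightarrow> x + y \<in> Zp p"
  unfolding Zp_iff
proof (elim exE conjE)
  fix a b c d
  assume "b \<noteq> 0" "coprime b (int p)" "x = of_int a / of_int b"
    "d \<noteq> 0" "coprime d (int p)" "y = of_int c / of_int d"
  thus "\<exists>a b. b \<noteq> 0 \<and> coprime b (int p) \<and> x + y = of_int a / of_int b"
    by (intro exI[of _ "a * d + c * b"] exI[of _ "b * d"]) (simp add: field_simps)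
qed

lemma Zp_mult: "x \<in> Zp p \<Longrightarrow> y \<in> Zp p \<Longrightarrow> x * y \<in> Zp p"
  unfolding Zp_iff
proof (elim exE conjE)
  fix a b c d
  assume "b \<noteq> 0" "coprime b (int p)" "x = of_int a / of_int b"
    "d \<noteq> 0" "coprime d (int p)" "y = of_int c / of_int d"
  thus "\<exists>a b. b \<noteq> 0 \<and> coprime b (int p) \<and> x * y = of_int a / of_int b"
    by (intro exI[of _ "a * c"] exI[of _ "b * d"]) (simp add: field_simps)
qed

lemma cong_Zp_of_int: "cong_Zp p (of_int a) (of_int b) \<longleftrightarrow> [a = b] (mod int p)"
proof
  assume "cong_Zp p (of_int a) (of_int b)"
  then obtain z where z: "z \<in> Zp p" and z': "(of_int a - of_int b :: rat) = of_nat p * z"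
    unfolding cong_Zp_def by blast
  from z obtain c d where d: "d \<noteq> 0" "coprime d (int p)" and zcd: "z = of_int c / of_int d"
    unfolding Zp_iff by blast
  have e: "(of_int a - of_int b :: rat) = of_nat p * (of_int c / of_int d)"
    using z' zcd by simp
  have "(of_int ((a - b) * d) :: rat) = (of_int a - of_int b) * of_int d"
    by simp
  also have "\<dots> = of_int (int p * c)"
    unfolding e using d(1) by simp
  finally have "(of_int ((a - b) * d) :: rat) = of_int (int p * c)" .
  hence "(a - b) * d = int p * c" by (simp only: of_int_eq_iff)
  hence "int p dvd (a - b) * d" by simp
  hence "int p dvd a - b" using d(2) by (metis coprime_commute coprime_dvd_mult_left_iff)
  thus "[a = b] (mod int p)" by (simp add: cong_iff_dvd_diff)
next
  assume "[a = b] (mod int p)"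
  then obtain k where "a - b = int p * k" by (auto simp: cong_iff_dvd_diff)
  hence "(of_int (a - b) :: rat) = of_int (int p * k)" by simp
  thus "cong_Zp p (of_int a) (of_int b)"
    unfolding cong_Zp_def by (intro conjI of_int_Zp bexI[of _ "of_int k"]) simp_all
qed

lemma Zp_residue:
  assumes "x \<in> Zp p"
  shows "\<exists>r. cong_Zp p (of_int r) x"
proof -
  from assms obtain a b where b: "b \<noteq> 0" "coprime b (int p)" and x: "x = of_int a / of_int b"
    unfolding Zp_iff by blast
  from cong_solve_coprime_int[OF b(2)] obtain c where "[b * c = 1] (mod int p)" by blast
  then obtain k where k: "b * c - 1 = int p * k" by (auto simp: cong_iff_dvd_diff)
  hence "(of_int (b * c - 1) :: rat) = of_int (int p * k)" by simp
  hence k': "(of_int b * of_int c :: rat) = 1 + of_nat p * of_int k" by simp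
  have "(of_int (a * c) :: rat) - x = of_int a * (of_int b * of_int c - 1) / of_int b"
    using b(1) by (simp add: x diff_divide_distrib right_diff_distrib)
  also have "\<dots> = of_nat p * (of_int (a * k) / of_int b)"
    unfolding k' by simp
  finally have "(of_int (a * c) :: rat) - x = of_nat p * (of_int (a * k) / of_int b)" .
  moreover have "of_int (a * k) / of_int b \<in> Zp p" unfolding Zp_iff using b by blast
  ultimately have "cong_Zp p (of_int (a * c)) x"
    unfolding cong_Zp_def using assms of_int_Zp by blast
  thus ?thesis by blast
qed

lemma Legendre_Zp_of_int: "Legendre_Zp (of_int a) p = Legendre a (int p)"
proof -
  have "(\<exists>y\<in>Zp p. cong_Zp p (y\<^sup>2) (of_int a)) \<longleftrightarrow> QuadRes (int p) a"
  proof
    assume "\<exists>y\<in>Zp p. cong_Zp p (y\<^sup>2) (of_int a)"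
    then obtain y u where y: "y \<in> Zp p" and u: "u \<in> Zp p" "y\<^sup>2 - of_int a = of_nat p * u"
      unfolding cong_Zp_def by blast
    from Zp_residue[OF y] obtain r v where v: "v \<in> Zp p" "of_int r - y = of_nat p * v"
      unfolding cong_Zp_def by blast
    have "(of_int (r\<^sup>2) :: rat) - of_int a
        = (of_int r - y) * (of_int r + y) + (y\<^sup>2 - of_int a)"
      by (simp add: algebra_simps power2_eq_square)
    also have "\<dots> = of_nat p * (v * (of_int r + y) + u)"
      unfolding u(2) v(2) by (simp add: algebra_simps)
    finally have "cong_Zp p (of_int (r\<^sup>2)) (of_int a)"
      unfolding cong_Zp_def using u v y
      by (intro conjI of_int_Zp bexI[of _ "v * (of_int r + y) + u"])
        (auto intro!: Zp_add Zp_mult)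
    hence "[r\<^sup>2 = a] (mod int p)" by (simp only: cong_Zp_of_int)
    thus "QuadRes (int p) a" unfolding QuadRes_def by blast
  next
    assume "QuadRes (int p) a"
    then obtain y where "[y\<^sup>2 = a] (mod int p)" unfolding QuadRes_def by blast
    hence "cong_Zp p (of_int (y\<^sup>2)) (of_int a)" by (simp only: cong_Zp_of_int)
    thus "\<exists>y\<in>Zp p. cong_Zp p (y\<^sup>2) (of_int a)"
      by (intro bexI[of _ "of_int y"]) simp_all
  qed
  moreover have "cong_Zp p (of_int a) 0 \<longleftrightarrow> [a = 0] (mod int p)"
    using cong_Zp_of_int[of p a 0] by simp
  ultimately show ?thesis by (simp add: Legendre_Zp_def Legendre_def)
qed

end

theory Submission
  imports Defs "HOL-Computational_Algebra.Polynomial"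
begin

text \<open>The three sequences are linked by binomial transforms: \<open>a\<close> is the transform of \<open>f\<close>
  with \<open>c = 1\<close> (Barrucand's identity), \<open>Q\<close> is that of \<open>f\<close> with \<open>c = -8\<close>, hence that of \<open>a\<close>
  with \<open>c = -9\<close>, where the transform of \<open>u\<close> is \<open>v k = (\<Sum>j\<le>k. (k choose j) * c ^ (k - j) * u j)\<close>.
  Put \<open>n = (p - 1) / 2\<close>. Since \<open>(2 k choose k) \<equiv> (-4) ^ k * (n choose k)\<close> modulo \<open>p\<close> for \<open>k < p\<close>,
  the binomial theorem gives
  \<open>(\<Sum>k<p. (2 k choose k) * v k / t ^ k) \<equiv> ((t - 4 c) / t) ^ n * (\<Sum>k<p. (2 k choose k) * u k / (t - 4 c) ^ k)\<close>,
  and Euler's criterion turns the \<open>n\<close>-th power into the Legendre symbol of \<open>t (t - 4 c)\<close>.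
  All four congruences are instances of this.\<close>

section \<open>Binomial transforms\<close>

text \<open>The monomial is the product of the two variables, so its power shifts both exponents by
  \<open>n - k\<close>. In an expansion of \<open>(F + M) ^ n\<close> each term thus falls back to
  the diagonal coefficient of \<open>F ^ k\<close>.\<close>

lemma coeff_monom_power_mult:
  fixes P :: "int poly poly"
  assumes "k \<le> n"
  shows "coeff (coeff (monom (monom 1 1) 1 ^ (n - k) * P) n) n = coeff (coeff P k) k"
  using assms by (simp add: monom_power coeff_monom_mult)

lemma coeff_mult_const: "coeff (p * [:c:]) n = coeff p n * (c :: 'a :: comm_semiring_1)"
  by (simp add: mult.commute)

text \<open>Calling the inner variable of \<^typ>\<open>int poly poly\<close> \<open>y\<close> and the outer one \<open>x\<close>, the
  polynomials below are \<open>(x + y) (1 + x) (1 + y)\<close> and \<open>(1 + x + y) (x y + x + y)\<close>. They differ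
  by the monomial \<open>x y\<close>, which is why their powers are linked by a binomial transform.\<close>

lemma coeff_Franel:
  "coeff (coeff (([:[:0, 1:], 1:] * [:1, 1:] * [:[:1, 1:]:]) ^ n) n) n = int (f_num n)"
proof -
  have "coeff (([:[:0, 1:], 1:] * [:1, 1:] * [:[:1, 1:]:]) ^ n) n
      = coeff ([:[:0, 1:], 1:] ^ n * [:1, 1:] ^ n) n * [:1, 1 :: int:] ^ n"
    by (simp only: power_mult_distrib poly_const_pow coeff_mult_const)
  \<comment> \<open>The first two factors each give \<open>n choose i\<close>; the third, constant
    in x, gives the last one when the coefficient of \<open>y ^ n\<close> is read off below.\<close>
  also have "\<dots> = (\<Sum>i\<le>n. monom (int (n choose i) ^ 2) (n - i) * [:1, 1:] ^ n)"
    unfolding coeff_mult sum_distrib_right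
  proof (intro sum.cong refl)
    fix i assume "i \<in> {..n}"
    hence i: "i \<le> n" "n choose (n - i) = n choose i" by (simp_all add: binomial_symmetric[symmetric])
    show "coeff ([:[:0, 1 :: int:], 1:] ^ n) i * coeff ([:1, 1:] ^ n) (n - i) * [:1, 1:] ^ n
      = monom (int (n choose i) ^ 2) (n - i) * [:1, 1:] ^ n"
      by (simp add: coeff_linear_poly_power i monom_altdef of_nat_poly power2_eq_square)
  qed
  also have "coeff \<dots> n = (\<Sum>i\<le>n. int (n choose i) ^ 3)"
    unfolding coeff_sum
    by (intro sum.cong refl)
       (simp add: coeff_monom_mult coeff_linear_poly_power power3_eq_cube power2_eq_square)
  finally show ?thesis by (simp add: f_num_def atMost_atLeast0)
qed

lemma coeff_a_num:
  "coeff (coeff (([:[:1, 1:], 1:] * [:[:0, 1:], [:1, 1:]:]) ^ n) n) n = int (a_num n)"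
proof -
  have "coeff (([:[:1, 1:], 1:] * [:[:0, 1:], [:1, 1:]:]) ^ n) n
      = (\<Sum>i\<le>n. monom (int (n choose i) ^ 2) i * [:1, 1 :: int:] ^ (2 * (n - i)))"
    unfolding coeff_mult power_mult_distrib
  proof (intro sum.cong refl)
    fix i assume "i \<in> {..n}"
    hence i: "i \<le> n" "n choose (n - i) = n choose i" "n - (n - i) = i"
      by (simp_all add: binomial_symmetric[symmetric])
    show "coeff ([:[:1, 1:], 1:] ^ n) i * coeff ([:[:0, 1:], [:1, 1:]:] ^ n) (n - i)
      = monom (int (n choose i) ^ 2) i * [:1, 1 :: int:] ^ (2 * (n - i))"
      by (simp only: power_even_eq)
        (simp add: coeff_linear_poly_power i monom_altdef of_nat_poly power2_eq_square mult_ac)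
  qed
  also have "coeff \<dots> n = (\<Sum>i\<le>n. int (n choose i) ^ 2 * int (2 * (n - i) choose (n - i)))"
    unfolding coeff_sum
    by (intro sum.cong refl) (simp add: coeff_monom_mult coeff_linear_poly_power)
  also have "\<dots> = (\<Sum>i\<le>n. int (n choose i) ^ 2 * int (2 * i choose i))"
    by (rule sum.reindex_bij_witness[of _ "\<lambda>i. n - i" "\<lambda>i. n - i"])
      (auto simp: binomial_symmetric[symmetric])
  finally show ?thesis by (simp add: a_num_def atMost_atLeast0)
qed

theorem Barrucand: "int (a_num n) = (\<Sum>k=0..n. int (n choose k) * int (f_num k))"
proof -
  let ?F = "[:[:0, 1:], 1:] * [:1, 1:] * [:[:1, 1:]:] :: int poly poly"
  let ?M = "monom (monom 1 1) 1 :: int poly poly"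
  have *: "[:[:1, 1:], 1:] * [:[:0, 1:], [:1, 1:]:] = ?F + ?M"
    by (simp add: monom_altdef one_pCons numeral_poly)
  have "int (a_num n) = coeff (coeff ((?F + ?M) ^ n) n) n"
    unfolding coeff_a_num[symmetric] * ..
  also have "\<dots> = (\<Sum>k\<le>n. int (n choose k) * coeff (coeff (?M ^ (n - k) * ?F ^ k) n) n)"
    unfolding binomial_ring
    by (simp only: coeff_sum of_nat_poly mult.assoc mult.commute[of "?F ^ _"])
       (simp add: of_nat_poly mult.commute)
  also have "\<dots> = (\<Sum>k\<le>n. int (n choose k) * int (f_num k))"
    by (intro sum.cong refl) (simp only: coeff_monom_power_mult coeff_Franel atMost_iff)
  finally show ?thesis by (simp add: atMost_atLeast0)
qed

text \<open>Composing transforms adds their parameters: \<open>choose_mult\<close> pulls out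
  \<open>n choose j\<close>, and the binomial theorem sums the rest.\<close>

lemma sum_binomial_mult_binomial:
  fixes x y :: "'a :: comm_semiring_1"
  assumes "j \<le> n"
  shows "(\<Sum>k=j..n. of_nat ((n choose k) * (k choose j)) * x ^ (n - k) * y ^ (k - j))
    = of_nat (n choose j) * (x + y) ^ (n - j)"
proof -
  have "(\<Sum>k=j..n. of_nat ((n choose k) * (k choose j)) * x ^ (n - k) * y ^ (k - j))
      = (\<Sum>k=j..n. of_nat ((n choose j) * ((n - j) choose (k - j))) * x ^ (n - k) * y ^ (k - j))"
    by (intro sum.cong refl) (auto simp: choose_mult)
  also have "\<dots> = (\<Sum>i\<le>n - j. of_nat ((n choose j) * ((n - j) choose i)) * x ^ (n - j - i) * y ^ i)"
    by (rule sum.reindex_bij_witness[of _ "\<lambda>i. i + j" "\<lambda>k. k - j"]) (use assms in auto)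
  also have "\<dots> = of_nat (n choose j) * (y + x) ^ (n - j)"
    unfolding binomial_ring sum_distrib_left by (intro sum.cong refl) (simp add: mult_ac)
  finally show ?thesis by (simp add: add.commute)
qed

lemma sum_triangle_swap:
  "(\<Sum>k=0..n. \<Sum>j=0..k. g k j) = (\<Sum>j=0..n. \<Sum>k=j..n. g k (j :: nat))"
  by (subst sum.Sigma, simp, simp, subst sum.Sigma, simp, simp)
     (rule sum.reindex_bij_witness[of _ prod.swap prod.swap], auto)

lemma Q_num_conv_a_num:
  "Q_num n = (\<Sum>k=0..n. int (n choose k) * (-9) ^ (n - k) * int (a_num k))"
proof -
  have "(\<Sum>k=0..n. int (n choose k) * (-9) ^ (n - k) * int (a_num k))
      = (\<Sum>k=0..n. \<Sum>j=0..k. of_nat ((n choose k) * (k choose j)) * (-9) ^ (n - k) * 1 ^ (k - j)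
          * int (f_num j))"
    by (simp add: Barrucand sum_distrib_left mult_ac)
  also have "\<dots> = (\<Sum>j=0..n. \<Sum>k=j..n. of_nat ((n choose k) * (k choose j)) * (-9) ^ (n - k)
      * 1 ^ (k - j) * int (f_num j))"
    by (rule sum_triangle_swap)
  also have "\<dots> = (\<Sum>j=0..n. int (n choose j) * (- 9 + 1) ^ (n - j) * int (f_num j))"
    by (intro sum.cong refl) (simp only: sum_distrib_right[symmetric] sum_binomial_mult_binomial
        atLeastAtMost_iff)
  finally show ?thesis by (simp add: Q_num_def)
qed

text \<open>Multiplied by \<open>t ^ n\<close>, the left side is the transform with parameter
  \<open>t\<close> of \<open>(-4) ^ k * v k\<close>, itself the transform with parameter
  \<open>-4 * c\<close> of \<open>(-4) ^ j * u j\<close>. The composite has parameter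
  \<open>t - 4 * c\<close>.\<close>

lemma sum_binomial_transform:
  fixes t :: "'a :: field" and c :: 'a
  assumes v: "\<And>k. v k = (\<Sum>j=0..k. of_nat (k choose j) * c ^ (k - j) * u j)"
    and t: "t \<noteq> 0" and w: "t - 4 * c \<noteq> 0"
  shows "(\<Sum>k=0..n. (-4) ^ k * of_nat (n choose k) * v k / t ^ k)
    = ((t - 4 * c) / t) ^ n * (\<Sum>k=0..n. (-4) ^ k * of_nat (n choose k) * u k / (t - 4 * c) ^ k)"
proof -
  have "(\<Sum>k=0..n. (-4) ^ k * of_nat (n choose k) * v k / t ^ k)
      = (\<Sum>k=0..n. \<Sum>j=0..k. (of_nat ((n choose k) * (k choose j)) * t ^ (n - k) * (-4 * c) ^ (k - j))
          * ((-4) ^ j * u j / t ^ n))"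
  proof (intro sum.cong refl)
    fix k assume k: "k \<in> {0..n}"
    have tn: "t ^ n = t ^ (n - k) * t ^ k" using k by (simp flip: power_add)
    show "(-4) ^ k * of_nat (n choose k) * v k / t ^ k
      = (\<Sum>j=0..k. (of_nat ((n choose k) * (k choose j)) * t ^ (n - k) * (-4 * c) ^ (k - j))
          * ((-4) ^ j * u j / t ^ n))"
      unfolding v sum_distrib_left sum_divide_distrib
    proof (intro sum.cong refl)
      fix j assume j: "j \<in> {0..k}"
      have "(-4 :: 'a) ^ k = (-4) ^ (k - j) * (-4) ^ j" using j by (simp flip: power_add)
      thus "(-4) ^ k * of_nat (n choose k) * (of_nat (k choose j) * c ^ (k - j) * u j) / t ^ k
        = (of_nat ((n choose k) * (k choose j)) * t ^ (n - k) * (-4 * c) ^ (k - j))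
          * ((-4) ^ j * u j / t ^ n)"
        unfolding power_mult_distrib tn using t by (simp add: field_simps)
    qed
  qed
  also have "\<dots> = (\<Sum>j=0..n. \<Sum>k=j..n. (of_nat ((n choose k) * (k choose j)) * t ^ (n - k)
      * (-4 * c) ^ (k - j)) * ((-4) ^ j * u j / t ^ n))"
    by (rule sum_triangle_swap)
  also have "\<dots> = (\<Sum>j=0..n. of_nat (n choose j) * (t + -4 * c) ^ (n - j) * ((-4) ^ j * u j / t ^ n))"
    by (intro sum.cong refl) (simp only: sum_distrib_right[symmetric] sum_binomial_mult_binomial
        atLeastAtMost_iff)
  also have "\<dots> = ((t - 4 * c) / t) ^ n *
      (\<Sum>k=0..n. (-4) ^ k * of_nat (n choose k) * u k / (t - 4 * c) ^ k)"
    unfolding sum_distrib_left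
    by (intro sum.cong refl) (use w in \<open>simp add: power_divide power_diff mult_ac\<close>)
  finally show ?thesis .
qed

section \<open>Congruences in the localization at \<open>p\<close>\<close>

text \<open>Both sides have the same ratio of consecutive terms modulo p: with
  \<open>p = 2 n + 1\<close>, \<open>2 (2 k + 1)\<close> and \<open>-4 (n - k)\<close> differ by
  \<open>2 p\<close>. The factor \<open>k + 1 < p\<close> can be cancelled.\<close>

lemma central_binomial_cong:
  fixes p :: nat
  assumes "prime p" "odd p" "k < p"
  shows "[int ((2 * k) choose k) = (-4) ^ k * int (((p - 1) div 2) choose k)] (mod int p)"
  using \<open>k < p\<close>
proof (induction k)
  case (Suc k)
  define n where "n = (p - 1) div 2"
  have p: "int p = 2 * int n + 1" using \<open>odd p\<close> by (auto elim!: oddE simp: n_def)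
  have c1: "int (Suc k) * int ((2 * Suc k) choose Suc k) = 2 * (2 * int k + 1) * int ((2 * k) choose k)"
  proof -
    have sym: "Suc (2 * k) choose k = Suc (2 * k) choose Suc k"
      using binomial_symmetric[of k "Suc (2 * k)"] by simp
    have "Suc k * ((2 * Suc k) choose Suc k) = 2 * (Suc k * (Suc (2 * k) choose Suc k))"
      using Suc_times_binomial[of k "Suc (2 * k)"] by (simp add: sym del: binomial_Suc_Suc)
    also have "\<dots> = 2 * (2 * k + 1) * ((2 * k) choose k)"
      unfolding Suc_times_binomial by simp
    finally have "int (Suc k * ((2 * Suc k) choose Suc k)) = int (2 * (2 * k + 1) * ((2 * k) choose k))"
      by (rule arg_cong)
    thus ?thesis by (simp only: of_nat_mult of_nat_add of_nat_1 of_nat_numeral)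
  qed
  \<comment> \<open>The factor \<open>n - k\<close> is formed in the integers; for
    \<open>k > n\<close> it is negative, but both binomial coefficients vanish.\<close>
  have c2: "int (Suc k) * int (n choose Suc k) = (int n - int k) * int (n choose k)"
  proof (cases "k \<le> n")
    case True
    have "Suc k * (n choose Suc k) = (n - k) * (n choose k)"
      by (metis binomial_absorb_comp binomial_absorption)
    thus ?thesis using True by (metis of_nat_diff of_nat_mult)
  qed (simp add: binomial_eq_0)
  have "[2 * (2 * int k + 1) = - 4 * (int n - int k)] (mod int p)"
  proof -
    have "2 * (2 * int k + 1) - - 4 * (int n - int k) = int p * 2"
      unfolding p by (simp add: algebra_simps)
    thus ?thesis unfolding cong_iff_dvd_diff by simp
  qed
  from cong_mult[OF this Suc.IH[folded n_def]] Suc.prems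
  have "[2 * (2 * int k + 1) * int ((2 * k) choose k)
      = - 4 * (int n - int k) * ((-4) ^ k * int (n choose k))] (mod int p)"
    by simp
  also have "- 4 * (int n - int k) * ((-4) ^ k * int (n choose k))
      = int (Suc k) * ((-4) ^ Suc k * int (n choose Suc k))"
    unfolding mult.left_commute[of "int (Suc k)"] c2 by (simp only: power_Suc mult_ac)
  finally have "[int (Suc k) * int ((2 * Suc k) choose Suc k)
      = int (Suc k) * ((-4) ^ Suc k * int (n choose Suc k))] (mod int p)"
    unfolding c1 .
  moreover have "\<not> p dvd Suc k" using Suc.prems by (auto dest: dvd_imp_le)
  from prime_imp_coprime[OF \<open>prime p\<close> this] have "coprime (int (Suc k)) (int p)"
    by (simp only: coprime_int_iff coprime_commute)
  ultimately show ?case unfolding n_def by (simp only: cong_mult_lcancel)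
qed simp

section \<open>Arithmetic, Euler's criterion and units in \<open>Zp p\<close>\<close>

lemma Zp_diff: "x \<in> Zp p \<Longrightarrow> y \<in> Zp p \<Longrightarrow> x - y \<in> Zp p"
  using Zp_add[OF _ Zp_mult[OF of_int_Zp[of "-1"]], of x p y] by simp

lemma Zp_power: "x \<in> Zp p \<Longrightarrow> x ^ k \<in> Zp p"
  using of_int_Zp[of 1] by (induction k) (auto intro: Zp_mult)

lemma cong_Zp_refl: "x \<in> Zp p \<Longrightarrow> cong_Zp p x x"
  unfolding cong_Zp_def using of_int_Zp[of 0 p] by force

lemma cong_Zp_sym: "cong_Zp p x y \<Longrightarrow> cong_Zp p y x"
proof -
  assume "cong_Zp p x y"
  then obtain z where z: "z \<in> Zp p" "x - y = of_nat p * z" "x \<in> Zp p" "y \<in> Zp p"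
    unfolding cong_Zp_def by blast
  have "0 - z \<in> Zp p" using Zp_diff[OF of_int_Zp[of 0] z(1)] by simp
  thus ?thesis unfolding cong_Zp_def using z by (intro conjI bexI[of _ "0 - z"]) auto
qed

lemma cong_Zp_add: "cong_Zp p x y \<Longrightarrow> cong_Zp p x' y' \<Longrightarrow> cong_Zp p (x + x') (y + y')"
  unfolding cong_Zp_def
  by (elim conjE bexE, intro conjI Zp_add) (assumption+, metis Zp_add add_diff_add distrib_left)

lemma cong_Zp_trans [trans]: "cong_Zp p x y \<Longrightarrow> cong_Zp p y z \<Longrightarrow> cong_Zp p x z"
  unfolding cong_Zp_def
  by (elim conjE bexE, intro conjI) (assumption+, metis Zp_add diff_add_cancel add_diff_eq distrib_left)

lemma cong_Zp_mult:
  assumes "cong_Zp p x y" "cong_Zp p x' y'"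
  shows "cong_Zp p (x * x') (y * y')"
proof -
  from assms obtain z z' where z: "z \<in> Zp p" "z' \<in> Zp p" "x - y = of_nat p * z" "x' - y' = of_nat p * z'"
    "x \<in> Zp p" "y \<in> Zp p" "x' \<in> Zp p" "y' \<in> Zp p"
    unfolding cong_Zp_def by blast
  have "x * x' - y * y' = (x - y) * x' + y * (x' - y')" by (simp add: algebra_simps)
  also have "\<dots> = of_nat p * (z * x' + y * z')" unfolding z(3,4) by (simp add: algebra_simps)
  finally show ?thesis unfolding cong_Zp_def using z by (blast intro: Zp_add Zp_mult)
qed

lemma cong_Zp_power: "cong_Zp p x y \<Longrightarrow> cong_Zp p (x ^ k) (y ^ k)"
  using cong_Zp_refl[OF of_int_Zp[of 1]] by (induction k) (auto intro: cong_Zp_mult)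

lemma cong_Zp_sum: "(\<And>i. i \<in> A \<Longrightarrow> cong_Zp p (g i) (h i)) \<Longrightarrow> cong_Zp p (sum g A) (sum h A)"
  using cong_Zp_refl[OF of_int_Zp[of 0]]
  by (induction A rule: infinite_finite_induct) (auto intro: cong_Zp_add)

lemma cong_Zp_trans_iff: "cong_Zp p x y \<Longrightarrow> cong_Zp p z x \<longleftrightarrow> cong_Zp p z y"
  using cong_Zp_trans cong_Zp_sym by blast

lemma Legendre_Zp_cong:
  assumes "cong_Zp p x y"
  shows "Legendre_Zp x p = Legendre_Zp y p"
proof -
  have "cong_Zp p x 0 \<longleftrightarrow> cong_Zp p y 0"
    using assms cong_Zp_trans cong_Zp_sym by blast
  thus ?thesis unfolding Legendre_Zp_def cong_Zp_trans_iff[OF assms] by simp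
qed

text \<open>Both sides depend only on the residue class of \<open>x\<close>, so an integer
  representative reduces this to \<open>euler_criterion\<close>.\<close>

lemma Legendre_Zp_euler:
  assumes "prime p" "odd p" "x \<in> Zp p"
  shows "cong_Zp p (of_int (Legendre_Zp x p)) (x ^ ((p - 1) div 2))"
proof -
  obtain r where r: "cong_Zp p (of_int r) x" using Zp_residue assms by blast
  have "2 < p" using assms prime_ge_2_nat[of p] by (cases "p = 2") auto
  hence "[Legendre r (int p) = r ^ ((p - 1) div 2)] (mod int p)"
    using euler_criterion[of p r] assms by simp
  hence "cong_Zp p (of_int (Legendre_Zp x p)) (of_int (r ^ ((p - 1) div 2)))"
    by (simp only: cong_Zp_of_int Legendre_Zp_cong[OF r, symmetric] Legendre_Zp_of_int)
  also have "cong_Zp p (of_int (r ^ ((p - 1) div 2))) (x ^ ((p - 1) div 2))"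
    using cong_Zp_power[OF r] by simp
  finally show ?thesis .
qed

lemma Zp_fermat:
  assumes "prime p" "x \<in> Zp p" "\<not> cong_Zp p x 0"
  shows "cong_Zp p (x ^ (p - 1)) 1"
proof -
  obtain r where r: "cong_Zp p (of_int r) x" using Zp_residue assms by blast
  have "\<not> cong_Zp p (of_int r) (of_int 0)"
    using cong_Zp_trans[OF cong_Zp_sym[OF r], of 0] assms(3) by auto
  hence "\<not> int p dvd r" by (simp only: cong_Zp_of_int cong_0_iff not_False_eq_True)
  \<comment> \<open>\<open>fermat_theorem\<close> concerns natural numbers, hence the least
    nonnegative residue.\<close>
  moreover have r': "r mod int p = int (nat (r mod int p))"
    using prime_gt_0_nat[OF assms(1)] by simp
  ultimately have "\<not> p dvd nat (r mod int p)"
    by (metis dvd_mod_iff dvd_refl int_dvd_int_iff)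
  hence "[nat (r mod int p) ^ (p - 1) = 1] (mod p)"
    using fermat_theorem assms(1) by blast
  hence "[(r mod int p) ^ (p - 1) = 1] (mod int p)"
    by (subst r') (metis cong_int_iff of_nat_1 of_nat_power)
  hence "[r ^ (p - 1) = 1] (mod int p)" by (simp add: cong_def power_mod)
  hence "cong_Zp p (of_int (r ^ (p - 1))) (of_int 1)" by (simp only: cong_Zp_of_int)
  thus ?thesis
    using cong_Zp_trans[OF cong_Zp_sym[OF cong_Zp_power[OF r, of "p - 1"]]] by simp
qed

text \<open>A nonzero residue forces the numerator to be prime to p, so the inverted fraction is
  again p-integral.\<close>

lemma Zp_inverse:
  assumes "prime p" "x \<in> Zp p" "\<not> cong_Zp p x 0"
  shows "x \<noteq> 0" "1 / x \<in> Zp p"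
proof -
  show "x \<noteq> 0" using assms(3) cong_Zp_refl[OF of_int_Zp[of 0]] by auto
  from assms(2) obtain a b where ab: "b \<noteq> 0" "coprime b (int p)" "x = of_int a / of_int b"
    unfolding Zp_iff by blast
  have "1 / of_int b \<in> Zp p" unfolding Zp_iff using ab by (metis of_int_1)
  have "\<not> int p dvd a"
  proof
    assume "int p dvd a"
    hence "cong_Zp p (of_int a) (of_int 0)" by (simp only: cong_Zp_of_int cong_0_iff)
    from cong_Zp_mult[OF this cong_Zp_refl[OF \<open>1 / of_int b \<in> Zp p\<close>]] show False
      using assms(3) ab(3) by simp
  qed
  hence "coprime a (int p)"
    using assms(1) by (metis coprime_commute prime_imp_coprime prime_nat_int_transfer)
  moreover have "a \<noteq> 0" using \<open>\<not> int p dvd a\<close> by auto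
  moreover have "1 / x = of_int b / of_int a" using ab by simp
  ultimately show "1 / x \<in> Zp p" unfolding Zp_iff by blast
qed

lemma not_cong_Zp_mult:
  assumes "prime p" "x \<in> Zp p" "y \<in> Zp p" "\<not> cong_Zp p x 0" "\<not> cong_Zp p y 0"
  shows "\<not> cong_Zp p (x * y) 0"
proof
  assume "cong_Zp p (x * y) 0"
  from cong_Zp_mult[OF cong_Zp_refl[OF Zp_inverse(2)[OF assms(1,2,4)]] this] show False
    using Zp_inverse(1)[OF assms(1,2,4)] assms(5) by simp
qed

section \<open>Binomial transforms of central binomial sums modulo p\<close>

lemma sum_central_binomial_cong:
  fixes t :: rat and u :: "nat \<Rightarrow> int"
  assumes p: "prime p" "odd p" and t: "t \<in> Zp p" "\<not> cong_Zp p t 0"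
  shows "cong_Zp p (\<Sum>k=0..p-1. of_nat ((2 * k) choose k) * of_int (u k) / t ^ k)
    (\<Sum>k=0..(p - 1) div 2. (-4) ^ k * of_nat (((p - 1) div 2) choose k) * of_int (u k) / t ^ k)"
proof -
  let ?n = "(p - 1) div 2"
  have "cong_Zp p (\<Sum>k=0..p-1. of_nat ((2 * k) choose k) * of_int (u k) / t ^ k)
      (\<Sum>k=0..p-1. (-4) ^ k * of_nat (?n choose k) * of_int (u k) / t ^ k)"
  proof (rule cong_Zp_sum)
    fix k assume "k \<in> {0..p-1}"
    hence "k < p" using prime_gt_0_nat[OF p(1)] by auto
    from central_binomial_cong[OF p this]
    have "cong_Zp p (of_int (int ((2 * k) choose k))) (of_int ((-4) ^ k * int (?n choose k)))"
      by (simp only: cong_Zp_of_int)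
    moreover have "of_int (u k) * (1 / t) ^ k \<in> Zp p"
      using Zp_inverse(2)[OF p(1) t] by (intro Zp_mult of_int_Zp Zp_power)
    ultimately have "cong_Zp p (of_int (int ((2 * k) choose k)) * (of_int (u k) * (1 / t) ^ k))
        (of_int ((-4) ^ k * int (?n choose k)) * (of_int (u k) * (1 / t) ^ k))"
      by (intro cong_Zp_mult cong_Zp_refl)
    thus "cong_Zp p (of_nat ((2 * k) choose k) * of_int (u k) / t ^ k)
        ((-4) ^ k * of_nat (?n choose k) * of_int (u k) / t ^ k)"
      by (simp add: power_divide)
  qed
  \<comment> \<open>For \<open>?n < k\<close> the coefficient \<open>?n choose k\<close> is
    zero.\<close>
  also have "(\<Sum>k=0..p-1. (-4) ^ k * of_nat (?n choose k) * of_int (u k) / t ^ k)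
      = (\<Sum>k=0..?n. (-4) ^ k * of_nat (?n choose k) * of_int (u k) / t ^ k)"
    by (rule sum.mono_neutral_right) auto
  finally show ?thesis .
qed

text \<open>The square factor \<open>s\<^sup>2\<close> removes the constants \<open>64\<close>, \<open>81\<close> and \<open>9\<close> from
  the Legendre symbol in the applications.\<close>

theorem binomial_transform_cong:
  fixes t w E :: rat and u v :: "nat \<Rightarrow> int" and c s :: int
  assumes p: "prime p" "odd p"
    and v: "\<And>k. v k = (\<Sum>j=0..k. int (k choose j) * c ^ (k - j) * u j)"
    and t: "t \<in> Zp p" "\<not> cong_Zp p t 0"
    and w: "w \<in> Zp p" "\<not> cong_Zp p w 0" "w = t - 4 * of_int c"
    and E: "E \<in> Zp p" "t * w = E * (of_int s)\<^sup>2"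
    and s: "\<not> int p dvd s"
  shows "cong_Zp p (\<Sum>k=0..p-1. of_nat ((2 * k) choose k) * of_int (v k) / t ^ k)
    (of_int (Legendre_Zp E p) * (\<Sum>k=0..p-1. of_nat ((2 * k) choose k) * of_int (u k) / w ^ k))"
proof -
  define n where "n = (p - 1) div 2"
  have n2: "p - 1 = 2 * n" using p(2) by (auto elim!: oddE simp: n_def)
  note t' = Zp_inverse[OF p(1) t] and w' = Zp_inverse[OF p(1) w(1,2)]
  have s': "\<not> cong_Zp p (of_int s) 0"
    using s cong_Zp_of_int[of p s 0] by (simp add: cong_0_iff)
  have wt: "w / t \<in> Zp p" using Zp_mult[OF w(1) t'(2)] by simp
  \<comment> \<open>Since \<open>p - 1 = 2 n\<close>, Fermat allows multiplying by
    \<open>t ^ (2 n)\<close>, which turns \<open>(w / t) ^ n\<close> into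
    \<open>(t w) ^ n = E ^ n * s ^ (p - 1)\<close>; Fermat for \<open>s\<close> leaves
    \<open>E ^ n\<close>, and Euler's criterion finishes.\<close>
  have "cong_Zp p ((w / t) ^ n * 1) ((w / t) ^ n * t ^ (p - 1))"
    by (intro cong_Zp_mult cong_Zp_refl Zp_power wt cong_Zp_sym[OF Zp_fermat[OF p(1) t]])
  also have "(w / t) ^ n * t ^ (p - 1) = E ^ n * of_int s ^ (p - 1)"
  proof -
    have "(w / t) ^ n * t ^ (p - 1) = (w / t * t\<^sup>2) ^ n"
      unfolding n2 power_mult power_mult_distrib ..
    also have "w / t * t\<^sup>2 = E * (of_int s)\<^sup>2"
      unfolding E(2)[symmetric] using t'(1) by (simp add: power2_eq_square)
    finally show ?thesis unfolding n2 power_mult power_mult_distrib .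
  qed
  also have "cong_Zp p \<dots> (E ^ n * 1)"
    by (intro cong_Zp_mult cong_Zp_refl Zp_power E(1) Zp_fermat p(1) of_int_Zp s')
  also have "cong_Zp p (E ^ n * 1) (of_int (Legendre_Zp E p))"
    using cong_Zp_sym[OF Legendre_Zp_euler[OF p E(1)]] by (simp add: n_def)
  finally have Leg: "cong_Zp p ((w / t) ^ n) (of_int (Legendre_Zp E p))" by simp
  \<comment> \<open>Truncate at \<open>n\<close>, apply the exact rational identity, then extend
    back to \<open>p - 1\<close>.\<close>
  have "cong_Zp p (\<Sum>k=0..p-1. of_nat ((2 * k) choose k) * of_int (v k) / t ^ k)
      (\<Sum>k=0..n. (-4) ^ k * of_nat (n choose k) * of_int (v k) / t ^ k)"
    unfolding n_def by (rule sum_central_binomial_cong[OF p t])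
  also have "(\<Sum>k=0..n. (-4) ^ k * of_nat (n choose k) * of_int (v k) / t ^ k)
      = (w / t) ^ n * (\<Sum>k=0..n. (-4) ^ k * of_nat (n choose k) * of_int (u k) / w ^ k)"
    unfolding w(3) by (rule sum_binomial_transform) (use t'(1) w'(1) w(3) in \<open>simp_all add: v\<close>)
  also have "cong_Zp p \<dots> (of_int (Legendre_Zp E p) *
      (\<Sum>k=0..p-1. of_nat ((2 * k) choose k) * of_int (u k) / w ^ k))"
    unfolding n_def
    by (intro cong_Zp_mult Leg[unfolded n_def]
        cong_Zp_sym[OF sum_central_binomial_cong[OF p w(1,2)]])
  finally show ?thesis .
qed

section \<open>The four congruences as instances of the transform\<close>

theorem theorem5p3:
  fixes p :: nat and m :: rat
  assumes "prime p" and "odd p" and "m \<in> Zp p"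
    and "\<not> cong_Zp p ((m + 2) * (m - 2)) 0"
  shows
    "cong_Zp p
       (\<Sum>k=0..p-1. of_nat ((2 * k) choose k) * of_nat (a_num k) / (m + 2) ^ k)
       (of_int (Legendre_Zp ((m + 2) * (m - 2)) p) *
        (\<Sum>k=0..p-1. of_nat ((2 * k) choose k) * of_nat (f_num k) / (m - 2) ^ k))
     \<and>
     cong_Zp p
       (\<Sum>k=0..p-1. of_nat ((2 * k) choose k) * of_int (Q_num k) / (-8 * (m + 2)) ^ k)
       (of_int (Legendre_Zp ((m + 2) * (m - 2)) p) *
        (\<Sum>k=0..p-1. of_nat ((2 * k) choose k) * of_nat (f_num k) / (-8 * (m - 2)) ^ k))
     \<and>
     (p \<noteq> 3 \<longrightarrow> cong_Zp p
       (\<Sum>k=0..p-1. of_nat ((2 * k) choose k) * of_int (Q_num k) / (-9 * (m + 2)) ^ k)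
       (of_int (Legendre_Zp ((m + 2) * (m - 2)) p) *
        (\<Sum>k=0..p-1. of_nat ((2 * k) choose k) * of_nat (a_num k) / (-9 * (m - 2)) ^ k)))
     \<and>
     (p \<noteq> 3 \<longrightarrow> \<not> cong_Zp p (9 * m - 14) 0 \<longrightarrow> cong_Zp p
       (\<Sum>k=0..p-1. of_nat ((2 * k) choose k) * of_int (Q_num k) / (-9 * (m + 2)) ^ k)
       (of_int (Legendre_Zp ((m + 2) * (9 * m - 14)) p) *
        (\<Sum>k=0..p-1. of_nat ((2 * k) choose k) * of_nat (f_num k) / (-9 * m + 14) ^ k)))"
proof -
  note p = \<open>prime p\<close> \<open>odd p\<close> and m = \<open>m \<in> Zp p\<close> and nz = assms(4)
  have int_Zp: "numeral k \<in> Zp p" "- numeral k \<in> Zp p" for k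
    using of_int_Zp[of "numeral k"] of_int_Zp[of "- numeral k"] by simp_all
  note Zp_intros = Zp_add Zp_diff Zp_mult int_Zp m
  have mem: "m + 2 \<in> Zp p" "m - 2 \<in> Zp p" "9 * m - 14 \<in> Zp p" "-9 * m + 14 \<in> Zp p"
    by (intro Zp_intros)+
  have zero: "cong_Zp p (x * y) 0" "cong_Zp p (y * x) 0" if "cong_Zp p x 0" "y \<in> Zp p" for x y
    using cong_Zp_mult[OF that(1) cong_Zp_refl[OF that(2)]] by (simp_all add: mult.commute)
  have nz': "\<not> cong_Zp p (m + 2) 0" "\<not> cong_Zp p (m - 2) 0"
    using nz zero mem by blast+
  \<comment> \<open>Written as a power of 2, so that a prime divisor must be 2, contrary to
    \<open>odd p\<close>.\<close>
  have dvd8: "\<not> int p dvd 2 ^ 3"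
    using p by (metis int_dvd_int_iff of_nat_numeral of_nat_power prime_dvd_power_nat
        primes_dvd_imp_eq two_is_prime_nat )
  have three_prime: "prime (3 :: nat)" by simp
  have dvd9: "\<not> int p dvd 3 ^ k" if "p \<noteq> 3" for k
  proof
    assume "int p dvd 3 ^ k"
    hence "p dvd 3 ^ k" by (metis int_dvd_int_iff of_nat_numeral of_nat_power)
    thus False using p(1) that by (metis prime_dvd_power_nat primes_dvd_imp_eq three_prime)
  qed
  have unit: "\<not> cong_Zp p (- numeral k * x) 0"
    if "\<not> int p dvd numeral k" "x \<in> Zp p" "\<not> cong_Zp p x 0" for k x
  proof (rule not_cong_Zp_mult[OF p(1) int_Zp(2) that(2) _ that(3)])
    show "\<not> cong_Zp p (- numeral k) 0"
      using cong_Zp_of_int[of p "- numeral k" 0] that(1) by (simp add: cong_0_iff)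
  qed
  have nz8: "\<not> cong_Zp p (-8 * (m + 2)) 0" "\<not> cong_Zp p (-8 * (m - 2)) 0"
    by (intro unit mem nz'; use dvd8 in simp)+
  \<comment> \<open>For \<open>p = 3\<close> these denominators would be zero modulo p.\<close>
  have nz9: "\<not> cong_Zp p (-9 * (m + 2)) 0" "\<not> cong_Zp p (-9 * (m - 2)) 0" if "p \<noteq> 3"
    by (intro unit mem nz'; use dvd9[OF that, of 2] in simp)+
  have 1: "cong_Zp p
       (\<Sum>k=0..p-1. of_nat ((2 * k) choose k) * of_int (int (a_num k)) / (m + 2) ^ k)
       (of_int (Legendre_Zp ((m + 2) * (m - 2)) p) *
        (\<Sum>k=0..p-1. of_nat ((2 * k) choose k) * of_int (int (f_num k)) / (m - 2) ^ k))"
    by (rule binomial_transform_cong[where c = 1 and s = 1])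
      (use p prime_gt_Suc_0_nat[OF p(1)] mem nz' in \<open>simp_all add: Barrucand Zp_mult\<close>)
  have 2: "cong_Zp p
       (\<Sum>k=0..p-1. of_nat ((2 * k) choose k) * of_int (Q_num k) / (-8 * (m + 2)) ^ k)
       (of_int (Legendre_Zp ((m + 2) * (m - 2)) p) *
        (\<Sum>k=0..p-1. of_nat ((2 * k) choose k) * of_int (int (f_num k)) / (-8 * (m - 2)) ^ k))"
  \<comment> \<open>\<open>-8 (m + 2) + 32 = -8 (m - 2)\<close>, and the product of the two is
    \<open>64 (m + 2) (m - 2)\<close>.\<close>
  proof (rule binomial_transform_cong[where c = "-8" and s = 8, OF p Q_num_def])
    show "\<not> int p dvd 8" using dvd8 by simp
  qed (rule Zp_intros nz8 | (simp add: algebra_simps power2_eq_square; fail))+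
  have 3: "cong_Zp p
       (\<Sum>k=0..p-1. of_nat ((2 * k) choose k) * of_int (Q_num k) / (-9 * (m + 2)) ^ k)
       (of_int (Legendre_Zp ((m + 2) * (m - 2)) p) *
        (\<Sum>k=0..p-1. of_nat ((2 * k) choose k) * of_int (int (a_num k)) / (-9 * (m - 2)) ^ k))"
    if "p \<noteq> 3"
  \<comment> \<open>Here \<open>Q\<close> is taken as a transform of \<open>a\<close>:
    \<open>-9 (m + 2) + 36 = -9 (m - 2)\<close>.\<close>
  proof (rule binomial_transform_cong[where c = "-9" and s = 9, OF p Q_num_conv_a_num])
    show "\<not> int p dvd 9" using dvd9[OF that, of 2] by simp
  qed (rule Zp_intros nz9 that | (simp add: algebra_simps power2_eq_square; fail))+
  have 4: "cong_Zp p
       (\<Sum>k=0..p-1. of_nat ((2 * k) choose k) * of_int (Q_num k) / (-9 * (m + 2)) ^ k)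
       (of_int (Legendre_Zp ((m + 2) * (9 * m - 14)) p) *
        (\<Sum>k=0..p-1. of_nat ((2 * k) choose k) * of_int (int (f_num k)) / (-9 * m + 14) ^ k))"
    if "p \<noteq> 3" "\<not> cong_Zp p (9 * m - 14) 0"
  \<comment> \<open>The same \<open>t\<close>, but \<open>Q\<close> as a transform of
    \<open>f\<close>: \<open>-9 (m + 2) + 32 = -9 m + 14\<close>. Now
    \<open>t w = 9 (m + 2) (9 m - 14)\<close>, so \<open>s = 3\<close>.\<close>
  proof (rule binomial_transform_cong[where c = "-8" and s = 3, OF p Q_num_def])
    show "\<not> cong_Zp p (-9 * m + 14) 0"
      using zero(1)[of "-9 * m + 14" "-1"] that(2) of_int_Zp[of "-1"] by auto
    show "\<not> int p dvd 3" using dvd9[OF that(1), of 1] by simp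
  qed (rule Zp_intros nz9 that(1) | (simp add: algebra_simps power2_eq_square; fail))+
  show ?thesis
    using 1 2 3 4 unfolding of_int_of_nat_eq by blast
qed

end
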